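(* Let $f$ be a polynomial (with real coefficients) of degree $d\ge 2$. Then the set $\{f(\lambda):\lambda\vdash n\}$ has cardinality $\Omega(n^{2(d-2)/3})$ as $n\to\infty$.
   Context: A partition $\lambda\vdash n$ is a nonincreasing sequence of positive integers $\lambda_1,\dots,\lambda_t$ with $\sum_i\lambda_i=n$. For a function $f$ and a partition (or multiset/sequence) $\lambda$, $f(\lambda)$ denotes $\sum_i f(\lambda_i)$, the sum of $f$ over the parts. *)

theory Defs
  imports
    "HOL-Computational_Algebra.Polynomial"
    "HOL-Library.Landau_Symbols"
begin

definition int_partitions :: "nat \<Rightarrow> nat list set"
  where "int_partitions n =
    {xs. sorted_wrt (\<ge>) xs \<and> (\<forall>x \<in> set xs. 0 < x) \<and> sum_list xs = n}"

definition poly_parts :: "real poly \<Rightarrow> nat list \<Rightarrow> real"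
  where "poly_parts f xs = (\<Sum>x\<leftarrow>xs. poly f (real x))"

text \<open>Finiteness ensures that cardinalities of sets indexed by partitions are genuine.\<close>

lemma finite_int_partitions: "finite (int_partitions n)"
proof (rule finite_subset)
  have len: "length xs \<le> sum_list xs" if "\<forall>x \<in> set xs. 0 < x" for xs :: "nat list"
    using that by (induction xs) auto
  show "int_partitions n \<subseteq> {xs. set xs \<subseteq> {..n} \<and> length xs \<le> n}"
    using len by (auto simp: int_partitions_def intro: member_le_sum_list)
  show "finite {xs. set xs \<subseteq> {..n} \<and> length xs \<le> n}"
    by (rule finite_lists_length_le) simp
qed

end

theory Submission
  imports Defs "HOL-Real_Asymp.Real_Asymp"
begin

text \<open>
  Padding a list of positive integers of sum at most \<open>n\<close> with ones turns it into a partition of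
  \<open>n\<close>, and replaces \<open>f\<close> by \<open>g x = f x - x f 1\<close>, up to the constant \<open>n f 1\<close>. A part
  \<open>k \<in> [n/4, n/2]\<close> gives about \<open>n\<close> values of \<open>g\<close> whose gaps are at least of order \<open>n^(d-1)\<close>, by the
  mean value theorem. Each gap accommodates all values attained by lists of sum at most
  \<open>\<delta> n^((d-1)/d)\<close>. Hence an exponent \<open>e\<close> improves to \<open>1 + e (d-1)/d\<close>, and iterating from
  \<open>e = 0\<close> yields every exponent below \<open>d\<close>.
\<close>

section \<open>Lists of bounded sum and padding to partitions\<close>

definition subpartition_values :: "real poly \<Rightarrow> real \<Rightarrow> real set" where
  "subpartition_values g x =
    poly_parts g ` {xs. (\<forall>k\<in>set xs. 0 < k) \<and> real (sum_list xs) \<le> x}"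

lemma poly_parts_Cons [simp]: "poly_parts f (k # xs) = poly f (real k) + poly_parts f xs"
  by (simp add: poly_parts_def)

text \<open>The ones contribute \<open>(n - sum_list xs) * poly f 1\<close>. Its dependence on
  \<open>xs\<close> is linear in the entries, so subtracting a linear polynomial from
  \<open>f\<close> absorbs it.\<close>

lemma poly_parts_padding:
  assumes "sum_list xs \<le> n"
  shows "poly_parts f (xs @ replicate (n - sum_list xs) 1) =
    real n * poly f 1 + poly_parts (f - [:0, poly f 1:]) xs"
proof -
  have "poly_parts (f - [:0, poly f 1:]) xs = poly_parts f xs - real (sum_list xs) * poly f 1"
    by (induction xs) (simp_all add: poly_parts_def algebra_simps)
  then show ?thesis
    using assms by (simp add: poly_parts_def sum_list_replicate of_nat_diff algebra_simps)
qed

text \<open>A sum over a list depends only on its multiset, so lists may be built in any order and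
  sorted at the end.\<close>

lemma poly_parts_mem_image_int_partitions:
  assumes "\<forall>k\<in>set xs. 0 < k" and "sum_list xs = n"
  shows "poly_parts f xs \<in> poly_parts f ` int_partitions n"
proof
  have "sum_list (rev (sort xs)) = sum_list xs"
    by (metis mset_rev mset_sort sum_mset_sum_list)
  then show "rev (sort xs) \<in> int_partitions n"
    using assms by (simp add: int_partitions_def sorted_wrt_rev)
  have "mset (map (\<lambda>x. poly f (real x)) (rev (sort xs))) = mset (map (\<lambda>x. poly f (real x)) xs)"
    by simp
  then show "poly_parts f xs = poly_parts f (rev (sort xs))"
    unfolding poly_parts_def by (metis sum_mset_sum_list)
qed

text \<open>Translation is injective, so this carries lower bounds for lists of sum at most
  \<open>n\<close> over to partitions of \<open>n\<close>.\<close>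

lemma shift_subpartition_values_subset:
  "(+) (real n * poly f 1) ` subpartition_values (f - [:0, poly f 1:]) (real n)
    \<subseteq> poly_parts f ` int_partitions n"
proof clarify
  fix v assume "v \<in> subpartition_values (f - [:0, poly f 1:]) (real n)"
  then obtain xs where xs: "\<forall>k\<in>set xs. 0 < k" "sum_list xs \<le> n"
    and v: "v = poly_parts (f - [:0, poly f 1:]) xs"
    by (auto simp: subpartition_values_def)
  have "poly_parts f (xs @ replicate (n - sum_list xs) 1) \<in> poly_parts f ` int_partitions n"
    by (rule poly_parts_mem_image_int_partitions) (use xs in \<open>auto simp: sum_list_replicate\<close>)
  then show "real n * poly f 1 + v \<in> poly_parts f ` int_partitions n"
    using xs v poly_parts_padding by simp
qed

lemma finite_subpartition_values: "finite (subpartition_values g x)"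
proof -
  have "{xs. (\<forall>k\<in>set xs. 0 < k) \<and> real (sum_list xs) \<le> x}
      \<subseteq> {xs. set xs \<subseteq> {..nat \<lfloor>x\<rfloor>} \<and> length xs \<le> nat \<lfloor>x\<rfloor>}"
  proof clarify
    fix xs :: "nat list" assume pos: "\<forall>k\<in>set xs. 0 < k" and "real (sum_list xs) \<le> x"
    then have le: "sum_list xs \<le> nat \<lfloor>x\<rfloor>"
      by (simp add: le_nat_floor)
    have "length xs \<le> sum_list xs"
      using pos by (induction xs) auto
    moreover have "k \<le> sum_list xs" if "k \<in> set xs" for k
      using that by (simp add: member_le_sum_list)
    ultimately show "set xs \<subseteq> {..nat \<lfloor>x\<rfloor>} \<and> length xs \<le> nat \<lfloor>x\<rfloor>"
      using le by fastforce
  qed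
  then show ?thesis
    unfolding subpartition_values_def
    by (intro finite_imageI) (rule finite_subset, assumption, simp add: finite_lists_length_le)
qed

lemma card_subpartition_values_pos:
  assumes "x \<ge> 0" shows "card (subpartition_values g x) \<ge> 1"
proof -
  have "poly_parts g [] \<in> subpartition_values g x"
    unfolding subpartition_values_def by (rule imageI) (use assms in simp)
  then show ?thesis
    using finite_subpartition_values card_gt_0_iff by (metis One_nat_def Suc_leI empty_iff)
qed

section \<open>Size and gap estimates for polynomial values\<close>

lemma poly_abs_le_power_degree:
  fixes g :: "real poly"
  assumes "y \<ge> 1"
  shows "\<bar>poly g y\<bar> \<le> (\<Sum>i\<le>degree g. \<bar>coeff g i\<bar>) * y ^ degree g"
proof -
  have "\<bar>poly g y\<bar> \<le> (\<Sum>i\<le>degree g. \<bar>coeff g i * y ^ i\<bar>)"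
    unfolding poly_altdef by (rule sum_abs)
  also have "\<dots> \<le> (\<Sum>i\<le>degree g. \<bar>coeff g i\<bar> * y ^ degree g)"
    by (rule sum_mono) (use assms in \<open>auto simp: abs_mult intro!: mult_left_mono power_increasing\<close>)
  finally show ?thesis
    by (simp add: sum_distrib_right)
qed

text \<open>For exponent at least 1, powers are superadditive on nonnegative reals, so splitting a
  sum into several parts gives no more than one part of full size.\<close>

lemma subpartition_values_bounded:
  fixes g :: "real poly"
  assumes "degree g \<ge> 1" and "v \<in> subpartition_values g x"
  shows "\<bar>v\<bar> \<le> (\<Sum>i\<le>degree g. \<bar>coeff g i\<bar>) * x ^ degree g"
proof -
  define K where "K = (\<Sum>i\<le>degree g. \<bar>coeff g i\<bar>)"
  have "K \<ge> 0"
    unfolding K_def by (rule sum_nonneg) simp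
  obtain xs where xs: "\<forall>k\<in>set xs. 0 < k" "real (sum_list xs) \<le> x" and v: "v = poly_parts g xs"
    using assms(2) by (auto simp: subpartition_values_def)
  have "\<bar>poly_parts g xs\<bar> \<le> K * real (sum_list xs) ^ degree g"
    using xs(1)
  proof (induction xs)
    case Nil
    then show ?case using \<open>K \<ge> 0\<close> by (simp add: poly_parts_def)
  next
    case (Cons k xs)
    let ?s = "real (sum_list xs)"
    obtain e where e: "degree g = Suc e"
      using assms(1) by (cases "degree g") auto
    \<comment> \<open>Expand one factor of \<open>(k + s) ^ Suc e\<close> and bound the remaining
      \<open>(k + s) ^ e\<close> below by \<open>k ^ e\<close> and by \<open>s ^ e\<close>
      respectively.\<close>
    have "real k ^ Suc e + ?s ^ Suc e \<le> (real k + ?s) ^ e * real k + (real k + ?s) ^ e * ?s"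
      unfolding power_Suc2 by (intro add_mono mult_right_mono power_mono) auto
    then have power: "real k ^ degree g + ?s ^ degree g \<le> (real k + ?s) ^ degree g"
      by (simp add: e algebra_simps)
    have "\<bar>poly_parts g (k # xs)\<bar> \<le> \<bar>poly g (real k)\<bar> + \<bar>poly_parts g xs\<bar>"
      by simp
    also have "\<dots> \<le> K * real k ^ degree g + K * ?s ^ degree g"
      using Cons poly_abs_le_power_degree[of "real k" g] unfolding K_def by (intro add_mono) auto
    also have "\<dots> \<le> K * (real k + ?s) ^ degree g"
      using power \<open>K \<ge> 0\<close> by (metis distrib_left mult_left_mono)
    finally show ?case by simp
  qed
  also have "\<dots> \<le> K * x ^ degree g"
    using \<open>K \<ge> 0\<close> xs(2) by (intro mult_left_mono power_mono) auto
  finally show ?thesis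
    by (simp add: v K_def)
qed

text \<open>The quotient \<open>poly p x / x ^ degree p\<close> tends to the leading coefficient, so
  half of its modulus serves as \<open>c\<close>.\<close>

lemma poly_abs_eventually_ge:
  fixes p :: "real poly"
  assumes "p \<noteq> 0"
  shows "\<exists>c>0. \<exists>N>0. \<forall>x\<ge>N. c * x ^ degree p \<le> \<bar>poly p x\<bar>"
proof -
  have "((\<lambda>x. \<bar>poly p x / x ^ degree p\<bar>) \<longlongrightarrow> \<bar>lead_coeff p\<bar>) at_top"
    by (intro tendsto_rabs filterlim_mono[OF poly_divide_tendsto_aux order_refl at_top_le_at_infinity])
  then have "eventually (\<lambda>x. \<bar>lead_coeff p\<bar> / 2 < \<bar>poly p x / x ^ degree p\<bar>) at_top"
    by (rule order_tendstoD) (use assms in simp)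
  then obtain N where N: "\<And>x. x \<ge> N \<Longrightarrow> \<bar>lead_coeff p\<bar> / 2 < \<bar>poly p x / x ^ degree p\<bar>"
    unfolding eventually_at_top_linorder by blast
  have "\<bar>lead_coeff p\<bar> / 2 * x ^ degree p \<le> \<bar>poly p x\<bar>" if "x \<ge> max N 1" for x
    using N[of x] that by (simp add: field_simps abs_divide)
  then show ?thesis
    using assms by (intro exI[of _ "\<bar>lead_coeff p\<bar> / 2"] conjI exI[of _ "max N 1"]) auto
qed

text \<open>The mean value theorem gives a factor \<open>y - x \<ge> 1\<close> times the derivative
  at some \<open>z > x\<close>, which has order at least \<open>x ^ (degree g - 1)\<close>. Allowing
  every \<open>y \<ge> x + 1\<close> separates all pairs of integers, not just neighbours.\<close>

lemma poly_gap:
  fixes g :: "real poly"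
  assumes "degree g \<ge> 1"
  shows "\<exists>c>0. \<exists>N>0. \<forall>x\<ge>N. \<forall>y\<ge>x + 1. c * x ^ (degree g - 1) \<le> \<bar>poly g y - poly g x\<bar>"
proof -
  have "pderiv g \<noteq> 0"
    using assms by (simp add: pderiv_eq_0_iff)
  from poly_abs_eventually_ge[OF this] obtain c N where c: "c > 0" "N > 0"
    and N: "\<And>x. x \<ge> N \<Longrightarrow> c * x ^ (degree g - 1) \<le> \<bar>poly (pderiv g) x\<bar>"
    by (auto simp: degree_pderiv)
  have "c * x ^ (degree g - 1) \<le> \<bar>poly g y - poly g x\<bar>" if "x \<ge> N" "y \<ge> x + 1" for x y
  proof -
    have "x < y" using that by simp
    then obtain z where z: "x < z" "poly g y - poly g x = (y - x) * poly (pderiv g) z"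
      using poly_MVT[of x y g] by blast
    have "c * x ^ (degree g - 1) \<le> c * z ^ (degree g - 1)"
      using c z that by (intro mult_left_mono power_mono) auto
    also have "\<dots> \<le> \<bar>poly (pderiv g) z\<bar>"
      using N z that by simp
    also have "\<dots> \<le> \<bar>y - x\<bar> * \<bar>poly (pderiv g) z\<bar>"
      using that by (intro mult_le_cancel_right1[THEN iffD2]) auto
    finally show ?thesis
      by (simp add: z abs_mult)
  qed
  with c show ?thesis by blast
qed

section \<open>Disjoint translates and growth exponents\<close>

text \<open>Prepending \<open>k\<close> to a list translates its value by \<open>poly g k\<close>.
  The values for \<open>y\<close> lie within a fixed radius of 0, and the gaps exceed twice that
  radius, so different \<open>k\<close> give disjoint translates.\<close>

lemma card_subpartition_values_ge_mult:
  fixes g :: "real poly"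
  assumes g: "degree g \<ge> 1" and A: "\<And>k. k \<in> A \<Longrightarrow> 0 < k \<and> real k + y \<le> x"
    and gap: "\<And>k l. k \<in> A \<Longrightarrow> l \<in> A \<Longrightarrow> k < l \<Longrightarrow>
      2 * ((\<Sum>i\<le>degree g. \<bar>coeff g i\<bar>) * y ^ degree g) < \<bar>poly g (real l) - poly g (real k)\<bar>"
  shows "card A * card (subpartition_values g y) \<le> card (subpartition_values g x)"
proof -
  let ?h = "\<lambda>(k, v). poly g (real k) + v"
  let ?V = "subpartition_values g y"
  have sep: "poly g (real k) + v \<noteq> poly g (real l) + w"
    if "k \<in> A" "l \<in> A" "k < l" "v \<in> ?V" "w \<in> ?V" for k l v w
    using gap[OF that(1-3)] subpartition_values_bounded[OF g that(4)]
      subpartition_values_bounded[OF g that(5)] by linarith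
  have "inj_on ?h (A \<times> ?V)"
  proof (rule inj_onI, clarify)
    fix k v l w
    assume *: "k \<in> A" "v \<in> ?V" "l \<in> A" "w \<in> ?V" "poly g (real k) + v = poly g (real l) + w"
    then have "k = l"
      using sep[of k l v w] sep[of l k w v] by (metis linorder_neqE_nat)
    with * show "k = l \<and> v = w" by simp
  qed
  moreover have "?h ` (A \<times> ?V) \<subseteq> subpartition_values g x"
  proof clarify
    fix k v assume k: "k \<in> A" and "v \<in> ?V"
    then obtain xs where xs: "\<forall>j\<in>set xs. 0 < j" "real (sum_list xs) \<le> y" "v = poly_parts g xs"
      by (auto simp: subpartition_values_def)
    have "poly_parts g (k # xs) \<in> subpartition_values g x"
      unfolding subpartition_values_def by (rule imageI) (use xs A[OF k] in auto)
    then show "poly g (real k) + v \<in> subpartition_values g x"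
      by (simp add: xs)
  qed
  ultimately have "card (A \<times> ?V) \<le> card (subpartition_values g x)"
    by (metis card_image card_mono finite_subpartition_values)
  then show ?thesis
    by (simp add: card_cartesian_product)
qed

text \<open>The variable is real, not an integer, so that the bound can be evaluated at
  \<open>\<delta> * x powr r\<close> in the inductive step.\<close>

definition value_growth :: "real poly \<Rightarrow> real \<Rightarrow> bool" where
  "value_growth g e \<longleftrightarrow>
    (\<exists>c>0. eventually (\<lambda>x. c * x powr e \<le> real (card (subpartition_values g x))) at_top)"

lemma value_growth_0: "value_growth g 0"
  unfolding value_growth_def
proof (intro exI conjI)
  show "\<forall>\<^sub>F x in at_top. 1 * x powr 0 \<le> real (card (subpartition_values g x))"
    using eventually_gt_at_top[of 0]
  proof eventually_elim
    case (elim x)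
    then show ?case using card_subpartition_values_pos[of x g] by simp
  qed
qed simp

lemma card_nat_in_real_interval:
  assumes "x \<ge> 0" shows "x / 4 - 1 \<le> real (card {k::nat. x / 4 \<le> real k \<and> real k \<le> x / 2})"
proof -
  have "{nat \<lceil>x / 4\<rceil>..nat \<lfloor>x / 2\<rfloor>} = {k::nat. x / 4 \<le> real k \<and> real k \<le> x / 2}"
    using assms by (auto simp: nat_le_iff ceiling_le_iff le_nat_iff le_floor_iff)
  then have "card {k::nat. x / 4 \<le> real k \<and> real k \<le> x / 2} = Suc (nat \<lfloor>x / 2\<rfloor>) - nat \<lceil>x / 4\<rceil>"
    by (metis card_atLeastAtMost)
  then show ?thesis
    using assms by linarith
qed

text \<open>With \<open>y\<close> of order \<open>x powr ((d - 1) / d)\<close>, the radius of order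
  \<open>y ^ d\<close> matches the gap of order \<open>x ^ (d - 1)\<close>. About
  \<open>x / 4\<close> translates, each with at least order \<open>y powr e\<close> values, give the
  new exponent.\<close>

lemma value_growth_step:
  fixes g :: "real poly"
  assumes d: "degree g = d" "d \<ge> 2" and e: "value_growth g e"
  shows "value_growth g (1 + e * ((real d - 1) / real d))"
proof -
  define r where "r = (real d - 1) / real d"
  have r: "0 < r" "r < 1" "r * real d = real (d - 1)"
    using d by (auto simp: r_def field_simps of_nat_diff)
  \<comment> \<open>The added 1 makes \<open>K\<close> positive, so that it can be divided
    by.\<close>
  define K where "K = (\<Sum>i\<le>degree g. \<bar>coeff g i\<bar>) + 1"
  have K: "K \<ge> 1"
    unfolding K_def by (simp add: sum_nonneg)
  obtain c where c: "c > 0"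
    and ev: "eventually (\<lambda>x. c * x powr e \<le> real (card (subpartition_values g x))) at_top"
    using e by (auto simp: value_growth_def)
  obtain b N where b: "b > 0" "N > 0" and gap:
    "\<And>x y. x \<ge> N \<Longrightarrow> y \<ge> x + 1 \<Longrightarrow> b * x ^ (d - 1) \<le> \<bar>poly g y - poly g x\<bar>"
    using poly_gap[of g] d by auto
  \<comment> \<open>Chosen so that \<open>y = \<delta> * x powr r\<close> satisfies
    \<open>4 * K * y ^ d = b * (x / 4) ^ (d - 1)\<close>, the gap guaranteed for parts of size at
    least \<open>x / 4\<close>.\<close>
  define B where "B = b / (4 ^ (d - 1) * 4 * K)"
  define \<delta> where "\<delta> = root d B"
  have B: "B > 0" using b K by (simp add: B_def)
  have \<delta>: "\<delta> > 0" "\<delta> ^ d = B"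
    using B d by (auto simp: \<delta>_def)
  define y where "y x = \<delta> * x powr r" for x :: real
  \<comment> \<open>Divergence of \<open>y\<close> lets the hypothesis be used at
    \<open>y x\<close>; the next fact gives \<open>y x \<le> x / 2\<close>, leaving room for a part
    up to \<open>x / 2\<close>.\<close>
  have lim: "filterlim y at_top at_top"
    unfolding y_def using \<delta>(1) r(1) by real_asymp
  have small: "eventually (\<lambda>x. \<delta> * x powr (r - 1) < 1 / 2) at_top"
    using \<delta>(1) r(2) by real_asymp
  have "eventually (\<lambda>x. c * \<delta> powr e / 8 * x powr (1 + e * r)
      \<le> real (card (subpartition_values g x))) at_top"
    \<comment> \<open>\<open>x \<ge> 8\<close> yields \<open>x / 4 - 1 \<ge> x / 8\<close> for the
      count of parts; \<open>x \<ge> 4 * N\<close> puts every part in the range where the gap bound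
      holds.\<close>
    using eventually_ge_at_top[of "max 8 (4 * N)"] small
      filterlim_iff[THEN iffD1, OF lim, rule_format, OF ev]
  proof eventually_elim
    case (elim x)
    then have x: "x \<ge> 8" "x \<ge> 4 * N" by auto
    define A where "A = {k::nat. x / 4 \<le> real k \<and> real k \<le> x / 2}"
    have "y x = x * (\<delta> * x powr (r - 1))"
      using x by (simp add: y_def powr_diff)
    also have "\<dots> \<le> x * (1 / 2)"
      using elim(2) x by (intro mult_left_mono) auto
    finally have half: "y x \<le> x / 2" by simp
    have "(x powr r) ^ d = x powr (r * real d)"
      using x by (simp add: powr_powr flip: powr_realpow)
    also have "\<dots> = x ^ (d - 1)"
      unfolding r(3) using x by (intro powr_realpow) auto
    finally have "K * y x ^ d = K * (B * x ^ (d - 1))"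
      by (simp add: y_def power_mult_distrib \<delta>)
    also have "\<dots> = b * (x / 4) ^ (d - 1) / 4"
      using K by (simp add: B_def power_divide field_simps)
    finally have Ky: "4 * (K * y x ^ d) = b * (x / 4) ^ (d - 1)" by simp
    have ypos: "y x > 0" using \<delta> x by (simp add: y_def)
    have "card A * card (subpartition_values g (y x)) \<le> card (subpartition_values g x)"
    proof (rule card_subpartition_values_ge_mult)
      show "0 < k \<and> real k + y x \<le> x" if "k \<in> A" for k
        using that half x by (auto simp: A_def intro!: gr0I)
      fix k l assume k: "k \<in> A" and "l \<in> A" "k < l"
      have "2 * ((\<Sum>i\<le>degree g. \<bar>coeff g i\<bar>) * y x ^ degree g) < 4 * (K * y x ^ d)"
        using ypos K unfolding d K_def mult.assoc[symmetric]
        by (intro mult_strict_right_mono zero_less_power)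
          (auto simp: algebra_simps intro!: add_pos_nonneg sum_nonneg)
      also have "\<dots> \<le> b * real k ^ (d - 1)"
        unfolding Ky using b k x by (intro mult_left_mono power_mono) (auto simp: A_def)
      also have "\<dots> \<le> \<bar>poly g (real l) - poly g (real k)\<bar>"
        using k x \<open>k < l\<close> by (intro gap) (auto simp: A_def)
      finally show "2 * ((\<Sum>i\<le>degree g. \<bar>coeff g i\<bar>) * y x ^ degree g)
          < \<bar>poly g (real l) - poly g (real k)\<bar>" .
    qed (use d in simp)
    then have prod: "real (card A) * real (card (subpartition_values g (y x)))
        \<le> real (card (subpartition_values g x))"
      by (metis of_nat_le_iff of_nat_mult)
    have "c * \<delta> powr e / 8 * x powr (1 + e * r) = (x / 8) * (c * y x powr e)"
      using x \<delta> by (simp add: y_def powr_mult powr_powr powr_add mult.commute)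
    also have "\<dots> \<le> real (card A) * real (card (subpartition_values g (y x)))"
      using card_nat_in_real_interval[of x] x c elim(3) unfolding A_def
      by (intro mult_mono) auto
    finally show ?case
      using prod by linarith
  qed
  moreover have "c * \<delta> powr e / 8 > 0" using c \<delta> by simp
  ultimately show ?thesis
    unfolding value_growth_def r_def by blast
qed

text \<open>The map from \<open>e\<close> to \<open>1 + e * (d - 1) / d\<close> fixes
  \<open>d\<close> and shrinks the distance to \<open>d\<close> by the factor
  \<open>(d - 1) / d\<close>; starting at 0, that distance is \<open>d\<close>.\<close>

lemma value_growth_iterate:
  fixes g :: "real poly"
  assumes "degree g = d" "d \<ge> 2"
  shows "value_growth g (real d * (1 - ((real d - 1) / real d) ^ m))"
proof (induction m)
  case 0
  then show ?case by (simp add: value_growth_0)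
next
  case (Suc m)
  have "1 + real d * (1 - ((real d - 1) / real d) ^ m) * ((real d - 1) / real d) =
      real d * (1 - ((real d - 1) / real d) ^ Suc m)"
    using assms(2) by (simp add: field_simps)
  then show ?case
    using value_growth_step[OF assms Suc] by simp
qed

lemma value_growth_less_degree:
  fixes g :: "real poly"
  assumes "degree g = d" "d \<ge> 2" "e < real d"
  shows "value_growth g e"
proof -
  \<comment> \<open>The ratio lies in \<open>(0, 1)\<close>, so its powers fall below any positive
    number; this \<open>m\<close> brings the exponent past \<open>e\<close>.\<close>
  have "\<exists>m. ((real d - 1) / real d) ^ m < 1 - e / real d"
    using assms by (intro real_arch_pow_inv) (auto simp: field_simps)
  then obtain m where "((real d - 1) / real d) ^ m < 1 - e / real d" ..
  then have le: "e \<le> real d * (1 - ((real d - 1) / real d) ^ m)" (is "e \<le> ?e")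
    using assms(2) by (simp add: field_simps)
  obtain c where c: "c > 0"
    and ev: "eventually (\<lambda>x. c * x powr ?e \<le> real (card (subpartition_values g x))) at_top"
    using value_growth_iterate[OF assms(1,2), of m] unfolding value_growth_def by blast
  from ev eventually_ge_at_top[of 1]
  have "eventually (\<lambda>x. c * x powr e \<le> real (card (subpartition_values g x))) at_top"
  proof eventually_elim
    case (elim x)
    have "c * x powr e \<le> c * x powr ?e"
      using c elim(2) le by (intro mult_left_mono powr_mono) auto
    with elim(1) show ?case by linarith
  qed
  with c show ?thesis unfolding value_growth_def by blast
qed

section \<open>Transfer to partitions\<close>

theorem mainTheorem2:
  fixes f :: "real poly" and d :: nat
  assumes "degree f = d" and "d \<ge> 2"
  shows "(\<lambda>n::nat. real (card (poly_parts f ` int_partitions n)))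
           \<in> \<Omega>(\<lambda>n. real n powr (2 * (real d - 2) / 3))"
proof -
  define g where "g = f - [:0, poly f 1:]"
  \<comment> \<open>The correction is at most linear and \<open>d \<ge> 2\<close>, so
    \<open>g\<close> keeps the degree of \<open>f\<close>.\<close>
  have "degree (- [:0, poly f 1:]) < degree f"
    using assms by (simp add: degree_pCons_eq_if)
  then have "degree g = d"
    using assms(1) degree_add_eq_left unfolding g_def by (metis diff_conv_add_uminus)
  \<comment> \<open>The required exponent is below \<open>d\<close>, since
    \<open>2 * d - 4 < 3 * d\<close>.\<close>
  then have "value_growth g (2 * (real d - 2) / 3)"
    using assms(2) by (intro value_growth_less_degree) auto
  then obtain c where c: "c > 0" and ev: "eventually (\<lambda>x.
      c * x powr (2 * (real d - 2) / 3) \<le> real (card (subpartition_values g x))) at_top"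
    unfolding value_growth_def by blast
  show ?thesis
  proof (rule landau_omega.bigI[OF c])
    show "\<forall>\<^sub>F n in at_top. c * norm (real n powr (2 * (real d - 2) / 3))
        \<le> norm (real (card (poly_parts f ` int_partitions n)))"
      using filterlim_iff[THEN iffD1, OF filterlim_real_sequentially, rule_format, OF ev]
    proof eventually_elim
      case (elim n)
      have "card (subpartition_values g (real n)) =
          card ((+) (real n * poly f 1) ` subpartition_values g (real n))"
        by (simp add: card_image)
      also have "\<dots> \<le> card (poly_parts f ` int_partitions n)"
        unfolding g_def
        by (intro card_mono shift_subpartition_values_subset finite_imageI finite_int_partitions)
      finally show ?case
        using elim by simp
    qed
  qed
qed

end
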